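(* Let $X$ and $Y$ be topological spaces, let $\mathcal{F}$ be a locally finite open cover of $X$, let $\mathcal{G}$ be a weak $AE(X)$-cover of $Y$, and let $C \colon \mathcal{F} \to \mathcal{G}$ be a carrier. Then each map weakly carried by $C$ (defined on a closed subset of $X$, with values in $Y$) extends to a map from the entire space $X$ to $Y$ that is also weakly carried by $C$.
   Context: Maps are continuous. A space $Z$ is an absolute extensor for a space $X$ if each map from a closed subset of $X$ into $Z$ extends over all of $X$; $AE(X)$ is the class of absolute extensors for $X$. For a class $\mathcal{C}$ of topological spaces, a cover is a weak $\mathcal{C}$-cover if the union of each (non-empty) collection of its elements that has a non-empty intersection belongs to $\mathcal{C}$. A carrier is a function $C \colon \mathcal{F} \to \mathcal{G}$ from a cover $\mathcal{F}$ of a space $X$ into a collection $\mathcal{G}$ of subsets of a topological space such that for each (non-empty) $\mathcal{A} \subset \mathcal{F}$, if $\bigcap \mathcal{A} \neq \emptyset$, then $\bigcap_{A \in \mathcal{A}} C(A) \neq \emptyset$. A map $f$ is weakly carried by $C$ if its domain $\operatorname{dom} f$ is a closed subset of $X$ and for each $x \in \operatorname{dom} f$ there exists $F \in \mathcal{F}$ such that $x \in F$ and $f(x) \in C(F)$. *)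

theory Defs
  imports "HOL-Analysis.Analysis"
begin

definition absolute_extensor :: "'b topology \<Rightarrow> 'a topology \<Rightarrow> bool" where
  "absolute_extensor Z X \<longleftrightarrow>
     (\<forall>A f. closedin X A \<and> continuous_map (subtopology X A) Z f \<longrightarrow>
        (\<exists>g. continuous_map X Z g \<and> (\<forall>x\<in>A. g x = f x)))"

definition AE_class :: "'a topology \<Rightarrow> 'b topology set" where
  "AE_class X = {Z. absolute_extensor Z X}"

definition is_cover :: "'a topology \<Rightarrow> 'a set set \<Rightarrow> bool" where
  "is_cover X \<F> \<longleftrightarrow> \<Union>\<F> = topspace X"

(* A union of cover elements is regarded as a space with the subspace topology. *)
definition weak_cover :: "'b topology set \<Rightarrow> 'b topology \<Rightarrow> 'b set set \<Rightarrow> bool" where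
  "weak_cover \<C> Y \<G> \<longleftrightarrow>
     is_cover Y \<G> \<and>
     (\<forall>\<H>. \<H> \<subseteq> \<G> \<and> \<H> \<noteq> {} \<and> \<Inter>\<H> \<noteq> {} \<longrightarrow> subtopology Y (\<Union>\<H>) \<in> \<C>)"

(* C is only meaningful on elements of \<F>; its values elsewhere are irrelevant. *)
definition is_carrier ::
  "'a topology \<Rightarrow> 'a set set \<Rightarrow> 'b topology \<Rightarrow> 'b set set \<Rightarrow> ('a set \<Rightarrow> 'b set) \<Rightarrow> bool" where
  "is_carrier X \<F> Y \<G> C \<longleftrightarrow>
     is_cover X \<F> \<and> (\<forall>G\<in>\<G>. G \<subseteq> topspace Y) \<and> C \<in> \<F> \<rightarrow> \<G> \<and>
     (\<forall>\<A>. \<A> \<subseteq> \<F> \<and> \<A> \<noteq> {} \<and> \<Inter>\<A> \<noteq> {} \<longrightarrow> (\<Inter>A\<in>\<A>. C A) \<noteq> {})"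

(* D is the domain of f; continuity of f on D is stated separately. *)
definition weakly_carried ::
  "'a topology \<Rightarrow> 'a set set \<Rightarrow> ('a set \<Rightarrow> 'b set) \<Rightarrow> 'a set \<Rightarrow> ('a \<Rightarrow> 'b) \<Rightarrow> bool" where
  "weakly_carried X \<F> C D f \<longleftrightarrow>
     closedin X D \<and> (\<forall>x\<in>D. \<exists>F\<in>\<F>. x \<in> F \<and> f x \<in> C F)"

end

theory Submission
  imports Defs
begin

text \<open>
  No normality of \<open>X\<close> is available, so the cover cannot be shrunk. What replaces shrinking is the
  following observation about an open cover \<open>\<F>\<close>: for every \<open>\<A> \<subseteq> \<F>\<close> the set of points all of
  whose cover elements lie in \<open>\<A>\<close> is closed, being the complement of the union of \<open>\<F> - \<A>\<close>. Such
  a set plays the role of the closed simplex spanned by \<open>\<A>\<close>, and the set \<open>K\<^sub>n\<close> of points that lie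
  in at most \<open>n\<close> elements of \<open>\<F>\<close> plays the role of a skeleton. It is closed because, for \<open>\<F>\<close> open
  and point-finite, the number of elements that contain a point is lower semicontinuous.

  The extension \<open>g\<close> is built skeleton by skeleton, as in obstruction theory with no obstructions.
  Suppose that \<open>g\<close> is given on \<open>K\<^sub>n \<union> D\<close>, and let \<open>\<A>\<close> have \<open>n + 1\<close> members and consist of all the
  elements of \<open>\<F>\<close> that contain a certain point. At a point of the closed simplex of \<open>\<A>\<close> the map
  \<open>g\<close>, where it is defined, takes values in the union of the \<open>C(A)\<close> with \<open>A \<in> \<A>\<close>. Since \<open>\<A>\<close> has a common point, so
  do these sets \<open>C(A)\<close>; hence their union is an absolute extensor for \<open>X\<close>, and \<open>g\<close> extends over the
  simplex (\<open>extend_into_union\<close>). Two different simplices of this size meet inside \<open>K\<^sub>n\<close>, and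
  the open simplices, together with their closures, form a locally finite family; so the extensions
  paste to a map on \<open>K\<^sub>n\<^sub>+\<^sub>1 \<union> D\<close> (\<open>extend_over_skeleton\<close>). The dimension of this
  structure may be unbounded, but every point has a neighbourhood contained in a single \<open>K\<^sub>n\<close>, and
  that makes the union of the successive extensions continuous.
\<close>

section \<open>The skeleta of an open cover\<close>

definition members_at :: "'a set set \<Rightarrow> 'a \<Rightarrow> 'a set set" where
  "members_at \<F> x = {F \<in> \<F>. x \<in> F}"

definition closed_simplex :: "'a topology \<Rightarrow> 'a set set \<Rightarrow> 'a set set \<Rightarrow> 'a set" where
  "closed_simplex X \<F> \<A> = {x \<in> topspace X. members_at \<F> x \<subseteq> \<A>}"

definition open_simplex :: "'a topology \<Rightarrow> 'a set set \<Rightarrow> 'a set set \<Rightarrow> 'a set" where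
  "open_simplex X \<F> \<A> = {x \<in> topspace X. members_at \<F> x = \<A>}"

text \<open>The index counts cover elements, so it exceeds the dimension of the skeleton by one.\<close>

definition skeleton :: "'a topology \<Rightarrow> 'a set set \<Rightarrow> nat \<Rightarrow> 'a set" where
  "skeleton X \<F> n = {x \<in> topspace X. card (members_at \<F> x) \<le> n}"

definition carrier_at :: "'a set set \<Rightarrow> ('a set \<Rightarrow> 'b set) \<Rightarrow> 'a \<Rightarrow> 'b set" where
  "carrier_at \<F> C x = \<Union>(C ` members_at \<F> x)"

lemma carrier_at_mono: "members_at \<F> x \<subseteq> \<A> \<Longrightarrow> carrier_at \<F> C x \<subseteq> \<Union>(C ` \<A>)"
  by (auto simp: carrier_at_def)

lemma weakly_carried_iff:
  "weakly_carried X \<F> C D f \<longleftrightarrow> closedin X D \<and> (\<forall>x\<in>D. f x \<in> carrier_at \<F> C x)"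
  by (auto simp: weakly_carried_def carrier_at_def members_at_def)

lemma closedin_closed_simplex:
  assumes "\<forall>F\<in>\<F>. openin X F"
  shows "closedin X (closed_simplex X \<F> \<A>)"
proof -
  have "closed_simplex X \<F> \<A> = topspace X - \<Union>(\<F> - \<A>)"
    by (auto simp: closed_simplex_def members_at_def)
  then show ?thesis
    using assms by (auto intro!: closedin_diff openin_Union)
qed

lemma closure_open_simplex_subset:
  assumes "\<forall>F\<in>\<F>. openin X F"
  shows "X closure_of open_simplex X \<F> \<A> \<subseteq> closed_simplex X \<F> \<A>"
  by (rule closure_of_minimal[OF _ closedin_closed_simplex[OF assms]])
     (auto simp: open_simplex_def closed_simplex_def)

lemma locally_finite_bound:
  assumes "locally_finite_in X \<F>" "x \<in> topspace X"
  obtains V \<B> where "openin X V" "x \<in> V" "finite \<B>" "\<forall>y\<in>V. members_at \<F> y \<subseteq> \<B>"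
proof -
  obtain V where "openin X V" "x \<in> V" "finite {F \<in> \<F>. F \<inter> V \<noteq> {}}"
    using assms unfolding locally_finite_in_def by blast
  then show thesis
    by (intro that[of V "{F \<in> \<F>. F \<inter> V \<noteq> {}}"]) (auto simp: members_at_def)
qed

lemma finite_members_at:
  assumes "locally_finite_in X \<F>" "x \<in> topspace X"
  shows "finite (members_at \<F> x)"
  by (rule locally_finite_bound[OF assms]) (auto intro: finite_subset)

lemma closedin_skeleton:
  assumes op: "\<forall>F\<in>\<F>. openin X F" and lf: "locally_finite_in X \<F>"
  shows "closedin X (skeleton X \<F> n)"
proof -
  have "\<exists>U. openin X U \<and> x \<in> U \<and> U \<subseteq> topspace X - skeleton X \<F> n"
    if x: "x \<in> topspace X - skeleton X \<F> n" for x
  proof (intro exI conjI)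
    \<comment> \<open>Near \<open>x\<close>, a point lies in every cover element in which \<open>x\<close> lies.\<close>
    let ?U = "topspace X \<inter> \<Inter>(members_at \<F> x)"
    have fin: "finite (members_at \<F> x)"
      using finite_members_at[OF lf] x by blast
    show "openin X ?U"
      using fin op by (auto simp: members_at_def intro: openin_Int_Inter)
    show "x \<in> ?U"
      using x by (auto simp: members_at_def)
    show "?U \<subseteq> topspace X - skeleton X \<F> n"
    proof
      fix y assume y: "y \<in> ?U"
      then have "members_at \<F> x \<subseteq> members_at \<F> y"
        by (auto simp: members_at_def)
      then have "card (members_at \<F> x) \<le> card (members_at \<F> y)"
        using finite_members_at[OF lf] y by (intro card_mono) auto
      then show "y \<in> topspace X - skeleton X \<F> n"
        using x y by (auto simp: skeleton_def)
    qed
  qed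
  then have "openin X (topspace X - skeleton X \<F> n)"
    by (subst openin_subopen) blast
  then show ?thesis
    by (auto simp: closedin_def skeleton_def)
qed

lemma skeleton_interiors_cover:
  assumes "locally_finite_in X \<F>" "x \<in> topspace X"
  obtains n where "x \<in> X interior_of skeleton X \<F> n"
proof -
  obtain V \<B> where V: "openin X V" "x \<in> V" "finite \<B>" "\<forall>y\<in>V. members_at \<F> y \<subseteq> \<B>"
    by (rule locally_finite_bound[OF assms])
  then have "V \<subseteq> skeleton X \<F> (card \<B>)"
    using openin_subset[OF V(1)] by (auto simp: skeleton_def intro: card_mono)
  then show thesis
    using that V by (meson interior_of_maximal subsetD)
qed

section \<open>Extension over one skeleton more\<close>

lemma absolute_extensor_subspace:
  assumes "absolute_extensor (subtopology Y B) X" "closedin X S"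
    and "continuous_map (subtopology X S) Y g" "\<forall>x\<in>S. g x \<in> B"
  obtains h where "continuous_map X Y h" "\<forall>x\<in>topspace X. h x \<in> B"
    "\<forall>x\<in>S. h x = g x"
proof -
  have "continuous_map (subtopology X S) (subtopology Y B) g"
    using assms(3,4) by (auto simp: continuous_map_in_subtopology)
  then obtain h where "continuous_map X (subtopology Y B) h" "\<forall>x\<in>S. h x = g x"
    using assms(1,2) unfolding absolute_extensor_def by blast
  then show thesis
    using that by (auto simp: continuous_map_in_subtopology)
qed

text \<open>
  A common point of the members of \<open>\<A>\<close> yields, by the carrier condition, a common point of their
  images under \<open>C\<close>, and then the weak cover makes the union of these images an absolute extensor.
\<close>

lemma extend_into_union:
  assumes weak: "weak_cover (AE_class X) Y \<G>" and carr: "is_carrier X \<F> Y \<G> C"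
    and \<A>: "\<A> \<subseteq> \<F>" "\<A> \<noteq> {}" "\<Inter>\<A> \<noteq> {}"
    and S: "closedin X S" "continuous_map (subtopology X S) Y g"
      "\<forall>x\<in>S. g x \<in> \<Union>(C ` \<A>)"
  obtains h where "continuous_map X Y h" "\<forall>x\<in>topspace X. h x \<in> \<Union>(C ` \<A>)"
    "\<forall>x\<in>S. h x = g x"
proof -
  have "C ` \<A> \<subseteq> \<G>" "\<Inter>(C ` \<A>) \<noteq> {}"
    using carr \<A> unfolding is_carrier_def by auto
  then have "absolute_extensor (subtopology Y (\<Union>(C ` \<A>))) X"
    using weak \<A>(2) unfolding weak_cover_def AE_class_def by blast
  then show thesis
    by (rule absolute_extensor_subspace[OF _ S]) (rule that)
qed

text \<open>
  The family of closed simplices itself need not be locally finite, because \<open>\<A>\<close> may contain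
  elements far away from a given point. The pasting therefore uses the closures of the open
  simplices, which form a locally finite family and lie in the closed simplices.
\<close>

lemma extend_over_skeleton:
  assumes op: "\<forall>F\<in>\<F>. openin X F" and lf: "locally_finite_in X \<F>"
    and weak: "weak_cover (AE_class X) Y \<G>" and carr: "is_carrier X \<F> Y \<G> C"
    and D: "closedin X D"
    and g: "continuous_map (subtopology X (skeleton X \<F> n \<union> D)) Y g"
    and gC: "\<forall>x \<in> skeleton X \<F> n \<union> D. g x \<in> carrier_at \<F> C x"
  shows "\<exists>g'. continuous_map (subtopology X (skeleton X \<F> (Suc n) \<union> D)) Y g' \<and>
    (\<forall>x \<in> skeleton X \<F> (Suc n) \<union> D. g' x \<in> carrier_at \<F> C x) \<and>
    (\<forall>x \<in> skeleton X \<F> n \<union> D. g' x = g x)"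
proof -
  let ?K = "skeleton X \<F> n \<union> D" and ?K' = "skeleton X \<F> (Suc n) \<union> D"
  define \<S> where "\<S> = {\<A>. card \<A> = Suc n \<and> open_simplex X \<F> \<A> \<noteq> {}}"
  have K: "closedin X ?K" and K': "closedin X ?K'"
    using closedin_skeleton[OF op lf] D by auto
  have KK': "?K \<subseteq> ?K'" and K'X: "?K' \<subseteq> topspace X"
    using closedin_subset[OF D] by (auto simp: skeleton_def)
  have "\<forall>\<A>\<in>\<S>. \<exists>h. continuous_map X Y h \<and> (\<forall>x \<in> topspace X. h x \<in> \<Union>(C ` \<A>)) \<and>
      (\<forall>x \<in> closed_simplex X \<F> \<A> \<inter> ?K. h x = g x)"
  proof
    fix \<A> assume "\<A> \<in> \<S>"
    then have \<A>: "\<A> \<subseteq> \<F>" "\<A> \<noteq> {}" "\<Inter>\<A> \<noteq> {}"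
      by (auto simp: \<S>_def open_simplex_def members_at_def)
    have "closedin X (closed_simplex X \<F> \<A> \<inter> ?K)"
      using closedin_closed_simplex[OF op] K by (rule closedin_Int)
    moreover have "continuous_map (subtopology X (closed_simplex X \<F> \<A> \<inter> ?K)) Y g"
      using g by (rule continuous_map_from_subtopology_mono) auto
    moreover have "\<forall>x \<in> closed_simplex X \<F> \<A> \<inter> ?K. g x \<in> \<Union>(C ` \<A>)"
    proof
      fix x assume x: "x \<in> closed_simplex X \<F> \<A> \<inter> ?K"
      have "members_at \<F> x \<subseteq> \<A>" "g x \<in> carrier_at \<F> C x"
        using x gC by (auto simp: closed_simplex_def)
      then show "g x \<in> \<Union>(C ` \<A>)"
        using carrier_at_mono[of \<F> x \<A> C] by blast
    qed
    ultimately show "\<exists>h. continuous_map X Y h \<and> (\<forall>x \<in> topspace X. h x \<in> \<Union>(C ` \<A>)) \<and>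
        (\<forall>x \<in> closed_simplex X \<F> \<A> \<inter> ?K. h x = g x)"
      by (rule extend_into_union[OF weak carr \<A>]) blast
  qed
  from bchoice[OF this] obtain h where
    ext: "\<forall>\<A>\<in>\<S>. continuous_map X Y (h \<A>) \<and> (\<forall>x \<in> topspace X. h \<A> x \<in> \<Union>(C ` \<A>)) \<and>
      (\<forall>x \<in> closed_simplex X \<F> \<A> \<inter> ?K. h \<A> x = g x)" ..
  then have h: "\<And>\<A>. \<A> \<in> \<S> \<Longrightarrow> continuous_map X Y (h \<A>)"
    and hC: "\<And>\<A> x. \<lbrakk>\<A> \<in> \<S>; x \<in> topspace X\<rbrakk> \<Longrightarrow> h \<A> x \<in> \<Union>(C ` \<A>)"
    and hg: "\<And>\<A> x. \<lbrakk>\<A> \<in> \<S>; x \<in> closed_simplex X \<F> \<A>; x \<in> ?K\<rbrakk> \<Longrightarrow> h \<A> x = g x"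
    by simp_all
  have new: "members_at \<F> x \<in> \<S>" if "x \<in> ?K'" "x \<notin> ?K" for x
    using that by (auto simp: \<S>_def skeleton_def open_simplex_def)
  have meet: "x \<in> ?K" if "\<A> \<in> \<S>" "\<B> \<in> \<S>" "\<A> \<noteq> \<B>"
    "x \<in> closed_simplex X \<F> \<A>" "x \<in> closed_simplex X \<F> \<B>" for \<A> \<B> x
  proof -
    have card: "card \<A> = Suc n" "card \<B> = Suc n"
      using that by (auto simp: \<S>_def)
    then have "finite \<A>" "finite \<B>"
      by (metis card.infinite nat.distinct(1))+
    moreover have "\<not> \<A> \<subseteq> \<B>"
      using card_subset_eq[OF \<open>finite \<B>\<close>] card \<open>\<A> \<noteq> \<B>\<close> by auto
    moreover have "members_at \<F> x \<subseteq> \<A>" "members_at \<F> x \<subseteq> \<B>"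
      using that by (auto simp: closed_simplex_def)
    ultimately have "card (members_at \<F> x) < Suc n"
      using psubset_card_mono[OF \<open>finite \<A>\<close>, of "members_at \<F> x"] card by auto
    then show ?thesis
      using that by (auto simp: skeleton_def closed_simplex_def)
  qed
  have piece: "X closure_of open_simplex X \<F> \<A> \<subseteq> closed_simplex X \<F> \<A>" for \<A>
    by (rule closure_open_simplex_subset[OF op])
  define g' where "g' x = (if x \<in> ?K then g x else h (members_at \<F> x) x)" for x
  \<comment> \<open>No point has an empty collection of cover elements, so the index \<open>{}\<close> is free for the old part.\<close>
  define T where "T \<A> = (if \<A> = {} then ?K else X closure_of open_simplex X \<F> \<A>)" for \<A>
  define p where "p \<A> = (if \<A> = {} then g else h \<A>)" for \<A>
  have ne: "{} \<notin> \<S>"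
    by (auto simp: \<S>_def)
  have simplex_K': "closed_simplex X \<F> \<A> \<subseteq> ?K'" if "\<A> \<in> \<S>" for \<A>
  proof
    fix x assume x: "x \<in> closed_simplex X \<F> \<A>"
    have "finite \<A>"
      using that by (auto simp: \<S>_def intro: card_ge_0_finite)
    then have "card (members_at \<F> x) \<le> card \<A>"
      using x by (auto simp: closed_simplex_def intro: card_mono)
    then show "x \<in> ?K'"
      using x that by (auto simp: \<S>_def closed_simplex_def skeleton_def)
  qed
  have "continuous_map (subtopology X ?K') Y g'"
  proof (rule pasting_lemma_locally_finite[where I = "insert {} \<S>" and T = T and f = p])
    fix x assume "x \<in> topspace (subtopology X ?K')"
    then have x: "x \<in> topspace X" "x \<in> ?K'"
      by auto
    obtain V \<B> where V: "openin X V" "x \<in> V" "finite \<B>" "\<forall>y\<in>V. members_at \<F> y \<subseteq> \<B>"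
      by (rule locally_finite_bound[OF lf x(1)])
    have "\<A> \<subseteq> \<B>" if "X closure_of open_simplex X \<F> \<A> \<inter> V \<noteq> {}" for \<A>
    proof -
      have "V \<inter> open_simplex X \<F> \<A> \<noteq> {}"
        using that openin_Int_closure_of_eq_empty[OF V(1)] by (simp add: Int_commute)
      then obtain y where "y \<in> open_simplex X \<F> \<A>" "y \<in> V"
        by blast
      then show ?thesis
        using V(4) by (auto simp: open_simplex_def)
    qed
    then have "{\<A> \<in> insert {} \<S>. T \<A> \<inter> (?K' \<inter> V) \<noteq> {}} \<subseteq> Pow \<B>"
      by (auto simp: T_def split: if_splits)
    then have "finite {\<A> \<in> insert {} \<S>. T \<A> \<inter> (?K' \<inter> V) \<noteq> {}}"
      using V(3) finite_subset by blast
    moreover have "openin (subtopology X ?K') (?K' \<inter> V)"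
      using V(1) openin_subtopology_Int2 by blast
    ultimately show "\<exists>V. openin (subtopology X ?K') V \<and> x \<in> V \<and>
        finite {\<A> \<in> insert {} \<S>. T \<A> \<inter> V \<noteq> {}}"
      using x V(2) by blast
  next
    fix \<A> assume \<A>: "\<A> \<in> insert {} \<S>"
    have sub: "T \<A> \<subseteq> ?K'"
      using \<A> KK' piece[of \<A>] simplex_K'[of \<A>] by (auto simp: T_def)
    have "closedin X (T \<A>)"
      using K by (simp add: T_def)
    then show "closedin (subtopology X ?K') (T \<A>)"
      using closedin_closed_subtopology[OF K'] sub by blast
    have "continuous_map (subtopology X (T \<A>)) Y (p \<A>)"
      using \<A> g h by (auto simp: T_def p_def intro: continuous_map_from_subtopology)
    then show "continuous_map (subtopology (subtopology X ?K') (T \<A>)) Y (p \<A>)"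
      using sub by (simp add: subtopology_subtopology Int_absorb1)
  next
    fix \<A> \<B> x
    assume *: "\<A> \<in> insert {} \<S>" "\<B> \<in> insert {} \<S>"
      "x \<in> topspace (subtopology X ?K') \<inter> T \<A> \<inter> T \<B>"
    show "p \<A> x = p \<B> x"
    proof (cases "\<A> = \<B>")
      case False
      have in_simplex: "x \<in> closed_simplex X \<F> \<A>'" if "\<A>' \<in> \<S>" "x \<in> T \<A>'" for \<A>'
        using that ne piece[of \<A>'] by (auto simp: T_def split: if_splits)
      have "x \<in> ?K"
      proof (cases "\<A> = {} \<or> \<B> = {}")
        case True
        then show ?thesis using * by (auto simp: T_def)
      next
        case False
        then show ?thesis
          using * in_simplex meet[of \<A> \<B> x] \<open>\<A> \<noteq> \<B>\<close> by blast
      qed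
      then have "p \<A>' x = g x" if "\<A>' \<in> insert {} \<S>" "x \<in> T \<A>'" for \<A>'
        using that hg in_simplex by (auto simp: p_def)
      then show ?thesis
        using * by simp
    qed simp
  next
    fix x assume "x \<in> topspace (subtopology X ?K')"
    then have x: "x \<in> topspace X" "x \<in> ?K'"
      by auto
    show "\<exists>\<A>. \<A> \<in> insert {} \<S> \<and> x \<in> T \<A> \<and> g' x = p \<A> x"
    proof (cases "x \<in> ?K")
      case True
      then show ?thesis
        by (intro exI[of _ "{}"]) (simp add: T_def p_def g'_def)
    next
      case False
      let ?A = "members_at \<F> x"
      have A: "?A \<in> \<S>" "?A \<noteq> {}"
        using new[OF x(2) False] ne by auto
      have "x \<in> open_simplex X \<F> ?A"
        using x by (simp add: open_simplex_def)
      then have "x \<in> X closure_of open_simplex X \<F> ?A"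
        using x(1) by (meson in_closure_of)
      then show ?thesis
        using A False by (intro exI[of _ ?A]) (simp add: T_def p_def g'_def)
    qed
  qed
  moreover have "g' x \<in> carrier_at \<F> C x" if "x \<in> ?K'" for x
  proof (cases "x \<in> ?K")
    case True
    then show ?thesis
      using gC by (simp add: g'_def)
  next
    case False
    have "x \<in> topspace X"
      using that K'X by (rule set_mp[rotated])
    then have "h (members_at \<F> x) x \<in> carrier_at \<F> C x"
      unfolding carrier_at_def by (rule hC[OF new[OF that False]])
    then show ?thesis
      using False by (simp add: g'_def)
  qed
  moreover have "\<forall>x \<in> ?K. g' x = g x"
    by (simp add: g'_def)
  ultimately show ?thesis
    by (intro exI[of _ g'] conjI ballI) (simp_all del: Un_iff)
qed

section \<open>The extension theorem\<close>

theorem mainTheorem3: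
  fixes X :: "'a topology" and Y :: "'b topology"
    and \<F> :: "'a set set" and \<G> :: "'b set set"
    and C :: "'a set \<Rightarrow> 'b set"
    and D :: "'a set" and f :: "'a \<Rightarrow> 'b"
  assumes "is_cover X \<F>" and "\<forall>F\<in>\<F>. openin X F" and "locally_finite_in X \<F>"
    and "weak_cover (AE_class X) Y \<G>"
    and "is_carrier X \<F> Y \<G> C"
    and "continuous_map (subtopology X D) Y f" and "weakly_carried X \<F> C D f"
  shows "\<exists>g. continuous_map X Y g \<and> weakly_carried X \<F> C (topspace X) g \<and>
             (\<forall>x\<in>D. g x = f x)"
proof -
  have D: "closedin X D" and fC: "\<forall>x\<in>D. f x \<in> carrier_at \<F> C x"
    using assms(7) by (auto simp: weakly_carried_iff)
  define K where "K n = skeleton X \<F> n \<union> D" for n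
  define good where "good n g \<longleftrightarrow> continuous_map (subtopology X (K n)) Y g \<and>
    (\<forall>x\<in>K n. g x \<in> carrier_at \<F> C x)" for n g
  have "skeleton X \<F> 0 = {}"
    using finite_members_at[OF assms(3)] assms(1)
    by (fastforce simp: skeleton_def members_at_def is_cover_def)
  then have f0: "good 0 f"
    using assms(6) fC by (simp add: good_def K_def)
  have step: "\<exists>g'. good (Suc n) g' \<and> (\<forall>x\<in>K n. g' x = g x)" if "good n g" for n g
    using extend_over_skeleton[OF assms(2-5) D, of n g] that unfolding good_def K_def by blast
  obtain G where G0: "G 0 = f" and G: "\<And>n. good n (G n)"
    and GS: "\<And>n x. x \<in> K n \<Longrightarrow> G (Suc n) x = G n x"
  proof -
    \<comment> \<open>Pinning the map at stage \<open>0\<close> makes every later one extend \<open>f\<close>.\<close>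
    have "\<exists>G. \<forall>n. (good n (G n) \<and> (n = 0 \<longrightarrow> G n = f)) \<and> (\<forall>x\<in>K n. G (Suc n) x = G n x)"
      by (rule dependent_nat_choice) (use f0 step in auto)
    then show thesis
      using that by blast
  qed
  have stable: "G m x = G n x" if "n \<le> m" "x \<in> K n" for m n x
    using that
  proof (induction m rule: dec_induct)
    case (step m)
    then have "x \<in> K m"
      by (auto simp: K_def skeleton_def)
    then show ?case
      using step GS by simp
  qed simp
  define g where "g x = G (card (members_at \<F> x)) x" for x
  have gG: "g x = G n x" if "x \<in> skeleton X \<F> n" for x n
    using that stable[of "card (members_at \<F> x)" n x] by (auto simp: g_def skeleton_def K_def)
  have "continuous_map X Y g"
  proof (rule pasting_lemma[where I = UNIV and T = "\<lambda>n. X interior_of skeleton X \<F> n" and f = G])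
    fix n
    show "openin X (X interior_of skeleton X \<F> n)"
      by simp
    show "continuous_map (subtopology X (X interior_of skeleton X \<F> n)) Y (G n)"
      using G[of n] interior_of_subset[of X "skeleton X \<F> n"] unfolding good_def K_def
      by (blast intro: continuous_map_from_subtopology_mono)
  next
    fix m n x
    assume "x \<in> topspace X \<inter> X interior_of skeleton X \<F> m \<inter> X interior_of skeleton X \<F> n"
    then show "G m x = G n x"
      using gG interior_of_subset by (metis IntD1 IntD2 subsetD)
  next
    fix x assume "x \<in> topspace X"
    then obtain n where "x \<in> X interior_of skeleton X \<F> n"
      using skeleton_interiors_cover[OF assms(3)] by metis
    then show "\<exists>n. n \<in> UNIV \<and> x \<in> X interior_of skeleton X \<F> n \<and> g x = G n x"
      using gG[of x n] interior_of_subset[of X "skeleton X \<F> n"] by blast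
  qed
  moreover have "g x \<in> carrier_at \<F> C x" if "x \<in> topspace X" for x
    using that G[of "card (members_at \<F> x)"] by (auto simp: g_def good_def K_def skeleton_def)
  moreover have "g x = f x" if "x \<in> D" for x
    using that stable[of 0 _ x] G0 by (simp add: g_def K_def)
  ultimately show ?thesis
    by (auto simp: weakly_carried_iff)
qed

end
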